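(* For every $n\ge0$, there is a one-to-one correspondence between the set of chains in plane trees with $n$ edges and the set of doubly rooted plane trees with $n$ edges in which each vertex on the path from the root to the distinguished vertex, excluding the distinguished vertex itself, is colored with one of two colors.
   Context: A plane tree is a rooted tree with linearly ordered children. A chain in a plane tree is a nonempty set of vertices all lying on a single path from the root to a leaf. "Chains in plane trees with $n$ edges" means pairs $(T,Q)$ with $T$ a plane tree with $n$ edges and $Q$ a chain of $T$. A doubly rooted plane tree is a plane tree with a distinguished vertex (possibly the root). *)

theory Defs
  imports Main "HOL-Library.Sublist" "HOL-Library.FuncSet"
begin

datatype plane_tree = Node "plane_tree list"

text \<open>
  Vertices are addressed by lists of child indices: \<^term>\<open>[]\<close> is the root, and
  \<^term>\<open>v @ [i]\<close> is the \<^term>\<open>i\<close>-th child of \<^term>\<open>v\<close>, counted from 0.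
\<close>

type_synonym vertex = "nat list"

fun is_vertex :: "plane_tree \<Rightarrow> vertex \<Rightarrow> bool" where
  "is_vertex T [] \<longleftrightarrow> True"
| "is_vertex (Node ts) (i # v) \<longleftrightarrow> i < length ts \<and> is_vertex (ts ! i) v"

definition vertices :: "plane_tree \<Rightarrow> vertex set" where
  "vertices T = {v. is_vertex T v}"

fun num_edges :: "plane_tree \<Rightarrow> nat" where
  "num_edges (Node ts) = (\<Sum>t\<leftarrow>ts. Suc (num_edges t))"

definition leaves :: "plane_tree \<Rightarrow> vertex set" where
  "leaves T = {v \<in> vertices T. \<nexists>i. v @ [i] \<in> vertices T}"

text \<open>The vertices on the path from the root to \<^term>\<open>v\<close>, both endpoints included.\<close>

definition root_path :: "vertex \<Rightarrow> vertex set" where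
  "root_path v = {u. prefix u v}"

definition is_chain :: "plane_tree \<Rightarrow> vertex set \<Rightarrow> bool" where
  "is_chain T Q \<longleftrightarrow> Q \<noteq> {} \<and> (\<exists>l \<in> leaves T. Q \<subseteq> root_path l)"

definition chains_in_plane_trees :: "nat \<Rightarrow> (plane_tree \<times> vertex set) set" where
  "chains_in_plane_trees n = {(T, Q). num_edges T = n \<and> is_chain T Q}"

datatype color = Black | White

text \<open>
  A coloring is an extensional function: it is constrained to be \<^const>\<open>undefined\<close> off the
  colored vertices, so that distinct functions represent distinct colorings.
\<close>

definition colored_doubly_rooted_trees ::
  "nat \<Rightarrow> (plane_tree \<times> vertex \<times> (vertex \<Rightarrow> color)) set" where
  "colored_doubly_rooted_trees n =
     {(T, v, c). num_edges T = n \<and> v \<in> vertices T \<and>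
        c \<in> (root_path v - {v}) \<rightarrow>\<^sub>E (UNIV :: color set)}"

end

theory Submission
  imports Defs
begin

text \<open>
  The bijection fixes the tree and sends a chain to its deepest vertex \<open>v\<close>. The rest of the chain
  is an arbitrary set of proper ancestors of \<open>v\<close>, encoded by coloring its members black.
\<close>

text \<open>Members of a chain are given only as prefixes of a leaf; this makes them vertices of the
  tree.\<close>

lemma is_vertex_prefix: "is_vertex T v \<Longrightarrow> prefix u v \<Longrightarrow> is_vertex T u"
proof (induction T v arbitrary: u rule: is_vertex.induct)
  case (2 ts i v)
  then show ?case by (cases u) auto
qed simp

lemma Cons_in_leaves:
  assumes "i < length ts" and "l \<in> leaves (ts ! i)"
  shows "i # l \<in> leaves (Node ts)"
  using assms by (auto simp: leaves_def vertices_def)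

text \<open>Descending to the first child for as long as there is one ends in a leaf.\<close>

lemma leaves_nonempty: "\<exists>l. l \<in> leaves T"
proof (induction T)
  case (Node ts)
  show ?case
  proof (cases ts)
    case Nil
    then have "[] \<in> leaves (Node ts)" by (auto simp: leaves_def vertices_def)
    then show ?thesis by blast
  next
    case (Cons t ts')
    then obtain l where "l \<in> leaves t" using Node by auto
    then have "0 # l \<in> leaves (Node ts)" using Cons by (intro Cons_in_leaves) auto
    then show ?thesis by blast
  qed
qed

text \<open>A chain needs a leaf as witness, while the distinguished vertex is arbitrary. Extending
  its root path down to a leaf supplies one.\<close>

lemma leaf_below_vertex: "is_vertex T v \<Longrightarrow> \<exists>l \<in> leaves T. prefix v l"
proof (induction T v rule: is_vertex.induct)
  case (1 T)
  then show ?case using leaves_nonempty[of T] by auto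
next
  case (2 ts i v)
  then obtain l where "l \<in> leaves (ts ! i)" "prefix v l" by auto
  then show ?case using 2 Cons_in_leaves[of i ts l] by (intro bexI[of _ "i # l"]) auto
qed

text \<open>The explicit map runs from colorings to chains, where no deepest vertex has to be found.
  The uncolored \<open>v\<close> is always inserted, which makes the set nonempty with deepest
  vertex \<open>v\<close>.\<close>

definition chain_of_coloring ::
  "plane_tree \<times> vertex \<times> (vertex \<Rightarrow> color) \<Rightarrow> plane_tree \<times> vertex set" where
  "chain_of_coloring = (\<lambda>(T, v, c). (T, insert v {u. strict_prefix u v \<and> c u = Black}))"

lemma root_path_minus_self: "root_path v - {v} = {u. strict_prefix u v}"
  by (auto simp: root_path_def)

lemma chain_of_coloring_in_chains:
  assumes "x \<in> colored_doubly_rooted_trees n"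
  shows "chain_of_coloring x \<in> chains_in_plane_trees n"
proof -
  obtain T v c where x: "x = (T, v, c)" by (cases x)
  with assms have T: "num_edges T = n" and v: "is_vertex T v"
    by (auto simp: colored_doubly_rooted_trees_def vertices_def)
  obtain l where l: "l \<in> leaves T" "prefix v l" using leaf_below_vertex[OF v] by blast
  then have "insert v {u. strict_prefix u v \<and> c u = Black} \<subseteq> root_path l"
    by (auto simp: root_path_def strict_prefix_def)
  with l(1) have "is_chain T (insert v {u. strict_prefix u v \<and> c u = Black})"
    unfolding is_chain_def by blast
  with T show ?thesis
    by (simp add: x chain_of_coloring_def chains_in_plane_trees_def)
qed

lemma inj_on_chain_of_coloring: "inj_on chain_of_coloring (colored_doubly_rooted_trees n)"
proof (rule inj_onI)
  fix x y
  assume x: "x \<in> colored_doubly_rooted_trees n" and y: "y \<in> colored_doubly_rooted_trees n"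
    and eq: "chain_of_coloring x = chain_of_coloring y"
  obtain T v c where xe: "x = (T, v, c)" by (cases x)
  obtain T' w d where ye: "y = (T', w, d)" by (cases y)
  from eq have T: "T = T'" and
    Q: "insert v {u. strict_prefix u v \<and> c u = Black} =
        insert w {u. strict_prefix u w \<and> d u = Black}"
    by (simp_all add: xe ye chain_of_coloring_def)
  \<comment> \<open>Each of \<open>v\<close> and \<open>w\<close> lies in the set built from the
    other, so each is a prefix of the other.\<close>
  from Q have "v = w \<or> strict_prefix v w" "w = v \<or> strict_prefix w v" by blast+
  then have "prefix v w" "prefix w v" by (auto simp: strict_prefix_def)
  then have vw: "v = w" by (rule prefix_order.antisym)
  have "c = d"
  proof (rule PiE_ext)
    show "c \<in> (root_path v - {v}) \<rightarrow>\<^sub>E UNIV" "d \<in> (root_path v - {v}) \<rightarrow>\<^sub>E UNIV"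
      using x y by (simp_all add: xe ye vw colored_doubly_rooted_trees_def)
    fix u assume "u \<in> root_path v - {v}"
    then have "strict_prefix u v" "u \<noteq> v" by (auto simp: root_path_minus_self)
    \<comment> \<open>Since \<open>u\<close> differs from \<open>v\<close>, its membership in the
      two equal sets depends on its color alone. With only two colors, agreeing on
      \<open>Black\<close> is agreeing.\<close>
    with Q have "c u = Black \<longleftrightarrow> d u = Black" unfolding vw by blast
    then show "c u = d u" by (cases "c u"; cases "d u") auto
  qed
  with T vw show "x = y" by (simp add: xe ye)
qed

text \<open>All members are prefixes of one leaf \<open>l\<close>, so they are comparable and a
  longest one lies below all others. It exists because lengths are bounded by that of
  \<open>l\<close>.\<close>

lemma chain_has_deepest_vertex:
  assumes "is_chain T Q"
  obtains v where "v \<in> Q" "is_vertex T v" "\<And>u. u \<in> Q \<Longrightarrow> prefix u v"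
proof -
  obtain l where l: "l \<in> leaves T" and Q: "Q \<subseteq> root_path l" "Q \<noteq> {}"
    using assms by (auto simp: is_chain_def)
  obtain u\<^sub>0 where u\<^sub>0: "u\<^sub>0 \<in> Q" using Q(2) by blast
  have "\<forall>u. u \<in> Q \<longrightarrow> length u < Suc (length l)"
    using Q(1) by (auto simp: root_path_def less_Suc_eq_le prefix_length_le)
  from ex_has_greatest_nat[of "\<lambda>u. u \<in> Q", OF u\<^sub>0 this] obtain v where v: "v \<in> Q" "\<And>u. u \<in> Q \<Longrightarrow> length u \<le> length v"
    by blast
  have "is_vertex T v"
    using is_vertex_prefix[of T l v] l Q(1) v(1)
    by (auto simp: leaves_def vertices_def root_path_def)
  moreover have "prefix u v" if "u \<in> Q" for u
    using that v Q(1) prefix_length_prefix[of u l v] by (auto simp: root_path_def)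
  ultimately show thesis using that v(1) by blast
qed

lemma chain_of_coloring_surj:
  assumes "x \<in> chains_in_plane_trees n"
  shows "x \<in> chain_of_coloring ` colored_doubly_rooted_trees n"
proof -
  obtain T Q where x: "x = (T, Q)" by (cases x)
  with assms have T: "num_edges T = n" and chain: "is_chain T Q"
    by (auto simp: chains_in_plane_trees_def)
  obtain v where v: "v \<in> Q" "is_vertex T v" "\<And>u. u \<in> Q \<Longrightarrow> prefix u v"
    using chain_has_deepest_vertex[OF chain] by blast
  \<comment> \<open>\<open>restrict\<close> gives the value \<open>undefined\<close> at
    \<open>v\<close> and off its root path, as extensionality demands; ancestors outside
    \<open>Q\<close> become \<open>White\<close>.\<close>
  define c where "c = restrict (\<lambda>u. if u \<in> Q then Black else White) (root_path v - {v})"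
  have "(T, v, c) \<in> colored_doubly_rooted_trees n"
    using T v(2) by (simp add: colored_doubly_rooted_trees_def vertices_def c_def)
  moreover have "c u = Black \<longleftrightarrow> u \<in> Q" if "strict_prefix u v" for u
    using that by (simp add: c_def root_path_minus_self)
  then have "Q = insert v {u. strict_prefix u v \<and> c u = Black}"
    using v(1,3) unfolding strict_prefix_def by blast
  then have "x = chain_of_coloring (T, v, c)"
    by (simp add: x chain_of_coloring_def)
  ultimately show ?thesis by blast
qed

theorem theorem5p1:
  fixes n :: nat
  shows "\<exists>f. bij_betw f (chains_in_plane_trees n) (colored_doubly_rooted_trees n)"
proof -
  have "bij_betw chain_of_coloring (colored_doubly_rooted_trees n) (chains_in_plane_trees n)"
    unfolding bij_betw_def
    using inj_on_chain_of_coloring chain_of_coloring_in_chains chain_of_coloring_surj by blast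
  \<comment> \<open>The required map from chains to colorings is the inverse.\<close>
  then show ?thesis using bij_betw_inv_into by blast
qed

end
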